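(* There is an absolute constant $K>0$ such that the following holds. Let $d\ge1$, $N\ge2$, let $\alpha_1,\dots,\alpha_d$ be real numbers, and let $w_n=(\alpha_1 n,\dots,\alpha_d n)\in(\mathbb{R}/\mathbb{Z})^d$. For each $i\in\{1,\dots,N\}$ choose $j=j(i)\in\{1,\dots,N\}$ with $j\ne i$ such that $\|w_i-w_j\|$ is minimal. Then the set $D=\{\pm(w_i-w_{j(i)}): i=1,\dots,N\}$ has at most $K(4/3)^d$ distinct elements.
   Context: For $t=(t_1,\dots,t_d)\in(\mathbb{R}/\mathbb{Z})^d$, $\|t\|=\min_{n\in\mathbb{Z}^d}|t-n|=\left(\sum_{i=1}^d\min_{n_i\in\mathbb{Z}}|t_i-n_i|^2\right)^{1/2}$, and the distance between $x,y$ is $\|x-y\|$. *)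

theory Defs
  imports Complex_Main
begin

definition dist_Z :: "real \<Rightarrow> real" where
  "dist_Z x = (INF n::int. \<bar>x - of_int n\<bar>)"

definition torus_norm :: "nat \<Rightarrow> (nat \<Rightarrow> real) \<Rightarrow> real" where
  "torus_norm d t = sqrt (\<Sum>k<d. (dist_Z (t k))\<^sup>2)"

text \<open>Canonical representative of the class of t in (R/Z)^d: coordinates in [0,1),
  zero outside 0..d-1. Two representatives define the same torus point iff
  their canonical representatives are equal.\<close>
definition torus_class :: "nat \<Rightarrow> (nat \<Rightarrow> real) \<Rightarrow> (nat \<Rightarrow> real)" where
  "torus_class d t = (\<lambda>k. if k < d then frac (t k) else 0)"

definition wpt :: "(nat \<Rightarrow> real) \<Rightarrow> nat \<Rightarrow> (nat \<Rightarrow> real)" where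
  "wpt \<alpha> n = (\<lambda>k. \<alpha> k * real n)"

end

theory Submission
  imports Defs "HOL-Computational_Algebra.Polynomial"
begin

text \<open>
  Write \<open>r m\<close> for the torus norm of \<open>m\<alpha>\<close>. A nearest neighbour of the point with index \<open>i\<close> is
  at an index distance \<open>m\<close> minimising \<open>r\<close> on \<open>{1..R}\<close>, where \<open>R = max (i - 1) (N - i)\<close> is at
  least \<open>(N - 1) / 2\<close>. Hence among the values \<open>m\<close> below \<open>(N - 1) / 2\<close>, and likewise among those
  above, a difference of two of them has norm at least that of either, so that their shortest
  representatives in Euclidean space pairwise enclose angles of at least 60 degrees. It remains
  to bound such spherical codes by \<open>O((4/3)^d)\<close>, which is the linear programming bound of
  Kabatiansky and Levenshtein.

  Let \<open>q\<^sub>k\<close> be the monic Gegenbauer polynomials of the sphere, with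
  \<open>t q\<^sub>k = q\<^sub>k\<^sub>+\<^sub>1 + \<beta>\<^sub>k q\<^sub>k\<^sub>-\<^sub>1\<close>. The test polynomial is \<open>(t - 1/2) g\<^sup>2\<close>, where \<open>g\<close> combines
  49 consecutive \<open>q\<^sub>k\<close> starting at \<open>k = 2d/25\<close> with weights that form an approximate eigenvector
  of the truncated recurrence, so that \<open>(t - 1/2) g\<close> again has nonnegative coefficients. This
  works because \<open>2 \<surd>\<beta>\<^sub>k > 1/2\<close> in this range. The resulting bound is a constant times the
  dimension of the space of spherical harmonics of degree \<open>2d/25\<close>, which is less than
  \<open>(4/3)^d\<close> up to a constant.
\<close>

section \<open>Positive definite kernels on the sphere\<close>

definition dot :: "nat \<Rightarrow> (nat \<Rightarrow> real) \<Rightarrow> (nat \<Rightarrow> real) \<Rightarrow> real" where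
  "dot n x y = (\<Sum>i<n. x i * y i)"

definition unit_vec :: "nat \<Rightarrow> (nat \<Rightarrow> real) \<Rightarrow> bool" where
  "unit_vec n x \<longleftrightarrow> dot n x x = 1"

text \<open>A class closed under the tangential derivatives below, so that a Gram representation can
  be differentiated repeatedly.\<close>

inductive polyfun :: "((nat \<Rightarrow> real) \<Rightarrow> real) \<Rightarrow> bool" where
  const: "polyfun (\<lambda>x. c)"
| coord: "polyfun (\<lambda>x. x i)"
| add: "polyfun f \<Longrightarrow> polyfun g \<Longrightarrow> polyfun (\<lambda>x. f x + g x)"
| mult: "polyfun f \<Longrightarrow> polyfun g \<Longrightarrow> polyfun (\<lambda>x. f x * g x)"

text \<open>For a unit vector \<open>x\<close> of dimension greater than \<open>m\<close>, the point \<open>x + h e\<^sub>m\<close> projected to the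
  sphere.\<close>

definition curve :: "nat \<Rightarrow> (nat \<Rightarrow> real) \<Rightarrow> real \<Rightarrow> nat \<Rightarrow> real" where
  "curve m x h i = (x i + (if i = m then h else 0)) / sqrt (1 + 2 * h * x m + h\<^sup>2)"

lemma curve_0 [simp]: "curve m x 0 = x"
  by (auto simp: curve_def)

lemma curve_radicand_pos:
  assumes "unit_vec n x" "m < n" "\<bar>h\<bar> < 1"
  shows "1 + 2 * h * x m + h\<^sup>2 > 0"
proof -
  have "(x m)\<^sup>2 \<le> (\<Sum>i<n. (x i)\<^sup>2)"
    using assms(2) by (intro member_le_sum) auto
  then have "(x m)\<^sup>2 \<le> 1"
    using assms(1) by (simp add: unit_vec_def dot_def power2_eq_square)
  then have "\<bar>x m\<bar> \<le> 1" by (simp add: abs_square_le_1)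
  then have "\<bar>h * x m\<bar> \<le> \<bar>h\<bar>"
    by (simp add: abs_mult mult_left_le)
  moreover have "(1 - \<bar>h\<bar>)\<^sup>2 > 0" using assms(3) by simp
  ultimately show ?thesis by (simp add: power2_eq_square algebra_simps abs_if split: if_splits)
qed

lemma unit_vec_curve:
  assumes "unit_vec n x" "m < n" "\<bar>h\<bar> < 1"
  shows "unit_vec n (curve m x h)"
proof -
  let ?D = "1 + 2 * h * x m + h\<^sup>2"
  have D: "?D > 0" by (rule curve_radicand_pos[OF assms])
  have "dot n (curve m x h) (curve m x h)
      = (\<Sum>i<n. (x i * x i + (if i = m then 2 * h * x m + h\<^sup>2 else 0)) / ?D)"
    unfolding dot_def
  proof (rule sum.cong[OF refl])
    fix i
    have "sqrt ?D * sqrt ?D = ?D" using D by simp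
    then show "curve m x h i * curve m x h i
        = (x i * x i + (if i = m then 2 * h * x m + h\<^sup>2 else 0)) / ?D"
      unfolding curve_def times_divide_times_eq
      by (simp add: algebra_simps power2_eq_square)
  qed
  also have "\<dots> = ((\<Sum>i<n. x i * x i) + (2 * h * x m + h\<^sup>2)) / ?D"
    using assms(2) by (simp add: sum_divide_distrib[symmetric] sum.distrib)
  also have "\<dots> = 1" using assms(1) D by (simp add: unit_vec_def dot_def)
  finally show ?thesis by (simp add: unit_vec_def)
qed

text \<open>For unit \<open>x\<close> the velocity at \<open>h = 0\<close> is the projection of the
  \<open>m\<close>-th basis vector to the tangent space at \<open>x\<close>.\<close>

lemma DERIV_curve:
  "((\<lambda>h. curve m x h i) has_real_derivative ((if i = m then 1 else 0) - x m * x i)) (at 0)"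
proof -
  have "((\<lambda>h. sqrt (1 + 2 * h * x m + h\<^sup>2)) has_real_derivative
      (2 * x m) * (inverse (sqrt (1 + 2 * 0 * x m + 0\<^sup>2)) / 2)) (at 0)"
    by (rule DERIV_chain2[OF DERIV_real_sqrt, THEN DERIV_cong])
      (auto intro!: derivative_eq_intros)
  then have 1: "((\<lambda>h. sqrt (1 + 2 * h * x m + h\<^sup>2)) has_real_derivative x m) (at 0)"
    by simp
  have 2: "((\<lambda>h. x i + (if i = m then h else 0)) has_real_derivative (if i = m then 1 else 0)) (at 0)"
    by (cases "i = m") (auto intro!: derivative_eq_intros)
  show ?thesis unfolding curve_def
    by (rule DERIV_cong[OF DERIV_divide[OF 2 1]]) auto
qed

lemma DERIV_curve_dot:
  assumes "m < n"
  shows "((\<lambda>h. dot n (curve m x h) y) has_real_derivative (y m - x m * dot n x y)) (at 0)"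
proof -
  have "((\<lambda>h. \<Sum>i<n. curve m x h i * y i) has_real_derivative
      (\<Sum>i<n. ((if i = m then 1 else 0) - x m * x i) * y i)) (at 0)"
    by (intro DERIV_sum DERIV_cmult_right DERIV_curve)
  moreover have "(\<Sum>i<n. ((if i = m then 1 else 0) - x m * x i) * y i) = y m - x m * dot n x y"
  proof -
    have "(\<Sum>i<n. ((if i = m then 1 else 0) - x m * x i) * y i)
       = (\<Sum>i<n. (if i = m then y i else 0) - x m * (x i * y i))"
      by (intro sum.cong) (auto simp: algebra_simps)
    also have "\<dots> = y m - x m * dot n x y"
      using assms by (simp add: sum_subtractf sum_distrib_left[symmetric] dot_def)
    finally show ?thesis .
  qed
  ultimately show ?thesis by (simp add: dot_def)
qed

definition tderiv :: "nat \<Rightarrow> ((nat \<Rightarrow> real) \<Rightarrow> real) \<Rightarrow> (nat \<Rightarrow> real) \<Rightarrow> real" where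
  "tderiv m f x = (THE D. ((\<lambda>h. f (curve m x h)) has_real_derivative D) (at 0))"

text \<open>At \<open>h = 0\<close> the root in \<open>curve\<close> has value 1 and derivative
  \<open>x m\<close>, so coordinates have polynomial derivatives; the sum and product rules do the
  rest.\<close>

lemma polyfun_tderiv:
  assumes "polyfun f"
  shows "polyfun (tderiv m f)"
    and DERIV_tderiv: "((\<lambda>h. f (curve m x h)) has_real_derivative tderiv m f x) (at 0)"
proof -
  have "\<exists>g. polyfun g \<and> (\<forall>x. ((\<lambda>h. f (curve m x h)) has_real_derivative g x) (at 0))"
    using assms
  proof (induction rule: polyfun.induct)
    case (const c)
    show ?case by (rule exI[of _ "\<lambda>x. 0"]) (auto intro: polyfun.const)
  next
    case (coord i)
    have "polyfun (\<lambda>x. (if i = m then 1 else 0) + (-1) * (x m * x i))"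
      by (intro polyfun.intros)
    then show ?case using DERIV_curve[of m _ i]
      by (intro exI[of _ "\<lambda>x. (if i = m then 1 else 0) + (-1) * (x m * x i)"]) auto
  next
    case (add f g)
    then obtain f' g' where *: "polyfun f'" "polyfun g'"
      "\<And>x. ((\<lambda>h. f (curve m x h)) has_real_derivative f' x) (at 0)"
      "\<And>x. ((\<lambda>h. g (curve m x h)) has_real_derivative g' x) (at 0)" by blast
    show ?case
      by (rule exI[of _ "\<lambda>x. f' x + g' x"]) (auto intro!: polyfun.intros * DERIV_add)
  next
    case (mult f g)
    then obtain f' g' where *: "polyfun f'" "polyfun g'"
      "\<And>x. ((\<lambda>h. f (curve m x h)) has_real_derivative f' x) (at 0)"
      "\<And>x. ((\<lambda>h. g (curve m x h)) has_real_derivative g' x) (at 0)" by blast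
    have "((\<lambda>h. f (curve m x h) * g (curve m x h)) has_real_derivative f' x * g x + g' x * f x) (at 0)" for x
      using DERIV_mult[OF *(3)[of x] *(4)[of x]] by simp
    then show ?case
      by (intro exI[of _ "\<lambda>x. f' x * g x + g' x * f x"]) (auto intro!: polyfun.intros * mult)
  qed
  then obtain g where g: "polyfun g"
    "\<And>x. ((\<lambda>h. f (curve m x h)) has_real_derivative g x) (at 0)" by blast
  have "tderiv m f = g" 
    unfolding tderiv_def by (intro ext the_equality g DERIV_unique[OF _ g(2)])
  then show "polyfun (tderiv m f)"
    and "((\<lambda>h. f (curve m x h)) has_real_derivative tderiv m f x) (at 0)"
    using g by auto
qed

text \<open>Positive definiteness with an explicit polynomial feature map, which can be
  differentiated and multiplied. The features form a list, so that repetitions are allowed and sums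
  of kernels are concatenations.\<close>

definition gram :: "nat \<Rightarrow> ((nat \<Rightarrow> real) \<Rightarrow> (nat \<Rightarrow> real) \<Rightarrow> real) \<Rightarrow> bool" where
  "gram n K \<longleftrightarrow> (\<exists>fs. (\<forall>f\<in>set fs. polyfun f) \<and>
     (\<forall>x y. unit_vec n x \<longrightarrow> unit_vec n y \<longrightarrow> K x y = (\<Sum>f\<leftarrow>fs. f x * f y)))"

section \<open>Closure properties of Gram kernels\<close>

lemma gram_add:
  assumes "gram n K" "gram n L"
  shows "gram n (\<lambda>x y. K x y + L x y)"
proof -
  obtain fs gs where "\<forall>f\<in>set fs. polyfun f" "\<forall>f\<in>set gs. polyfun f"
     "\<forall>x y. unit_vec n x \<longrightarrow> unit_vec n y \<longrightarrow> K x y = (\<Sum>f\<leftarrow>fs. f x * f y)"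
     "\<forall>x y. unit_vec n x \<longrightarrow> unit_vec n y \<longrightarrow> L x y = (\<Sum>f\<leftarrow>gs. f x * f y)"
    using assms unfolding gram_def by blast
  then show ?thesis unfolding gram_def by (intro exI[of _ "fs @ gs"]) auto
qed

lemma gram_zero: "gram n (\<lambda>x y. 0)"
  unfolding gram_def by (rule exI[of _ "[]"]) auto

lemma gram_sum:
  fixes k :: nat
  shows "(\<And>m. m < k \<Longrightarrow> gram n (K m)) \<Longrightarrow> gram n (\<lambda>x y. \<Sum>m<k. K m x y)"
  by (induction k) (auto intro: gram_add gram_zero)

lemma gram_cong:
  assumes "gram n K" "\<And>x y. unit_vec n x \<Longrightarrow> unit_vec n y \<Longrightarrow> K x y = L x y"
  shows "gram n L"
proof -
  obtain fs where "\<forall>f\<in>set fs. polyfun f"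
     "\<And>x y. unit_vec n x \<Longrightarrow> unit_vec n y \<Longrightarrow> K x y = (\<Sum>f\<leftarrow>fs. f x * f y)"
    using assms(1) unfolding gram_def by blast
  then show ?thesis unfolding gram_def using assms(2) by (intro exI[of _ fs]) auto
qed

lemma gram_scale:
  assumes "gram n K" "c \<ge> 0"
  shows "gram n (\<lambda>x y. c * K x y)"
proof -
  obtain fs where fs: "\<forall>f\<in>set fs. polyfun f"
     "\<And>x y. unit_vec n x \<Longrightarrow> unit_vec n y \<Longrightarrow> K x y = (\<Sum>f\<leftarrow>fs. f x * f y)"
    using assms(1) unfolding gram_def by blast
  have "c * (\<Sum>f\<leftarrow>fs. f x * f y) = (\<Sum>f\<leftarrow>map (\<lambda>f x. sqrt c * f x) fs. f x * f y)" for x y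
  proof -
    have "sqrt c * f x * (sqrt c * f y) = c * (f x * f y)" for f :: "(nat \<Rightarrow> real) \<Rightarrow> real"
    proof -
      have "sqrt c * f x * (sqrt c * f y) = (sqrt c * sqrt c) * (f x * f y)" by (simp only: ac_simps)
      then show ?thesis using assms(2) by simp
    qed
    then show ?thesis by (simp only: map_map o_def sum_list_const_mult)
  qed
  then show ?thesis unfolding gram_def using fs
    by (intro exI[of _ "map (\<lambda>f x. sqrt c * f x) fs"]) (auto intro: polyfun.intros)
qed

lemma DERIV_sum_list:
  assumes "\<And>f. f \<in> set fs \<Longrightarrow> ((\<lambda>h. F f h) has_real_derivative F' f) (at a)"
  shows "((\<lambda>h. \<Sum>f\<leftarrow>fs. F f h) has_real_derivative (\<Sum>f\<leftarrow>fs. F' f)) (at a)"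
  using assms by (induction fs) (auto intro!: DERIV_add)

lemma DERIV_local_cong:
  assumes "(f has_real_derivative D) (at 0)" "\<And>h. \<bar>h\<bar> < 1 \<Longrightarrow> f h = g h"
  shows "(g has_real_derivative D) (at 0)"
proof (rule has_field_derivative_transform_within_open[OF assms(1)])
  show "open {-1<..<1::real}" by simp
qed (use assms(2) in auto)

text \<open>If \<open>f\<close> is the restriction of a harmonic polynomial of degree \<open>k\<close>, then for
  \<open>a = k + n - 2\<close> the function \<open>a x\<^sub>m f - \<partial>\<^sub>m f\<close> (tangential derivative) is a multiple of the harmonic
  part of \<open>x\<^sub>m f\<close> of degree \<open>k + 1\<close>. Applying this operator in both arguments maps the zonal kernel
  of degree \<open>k\<close>, after summation over \<open>m\<close>, to that of degree \<open>k + 1\<close>, while keeping it visibly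
  positive definite.\<close>

lemma gram_raise:
  fixes p :: "real poly" and a :: real
  assumes "gram n (\<lambda>x y. poly p (dot n x y))" "m < n"
  shows "gram n (\<lambda>x y. let t = dot n x y; p0 = poly p t; p1 = poly (pderiv p) t;
      p2 = poly (pderiv (pderiv p)) t in
      a\<^sup>2 * (x m * y m) * p0 - a * (x m * (x m - t * y m) + y m * (y m - t * x m)) * p1
      + (p2 * ((y m - t * x m) * (x m - t * y m)) + p1 * (1 - x m * x m - (y m - t * x m) * y m)))"
proof -
  obtain fs where fs: "\<And>f. f \<in> set fs \<Longrightarrow> polyfun f"
     "\<And>x y. unit_vec n x \<Longrightarrow> unit_vec n y \<Longrightarrow> poly p (dot n x y) = (\<Sum>f\<leftarrow>fs. f x * f y)"
    using assms(1) unfolding gram_def by blast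
  let ?D = "tderiv m"
  have dot_sym: "dot n x y = dot n y x" for x y by (simp add: dot_def mult.commute)
  have D1: "(\<Sum>f\<leftarrow>fs. ?D f x * f y) = poly (pderiv p) (dot n x y) * (y m - x m * dot n x y)"
    if u: "unit_vec n x" "unit_vec n y" for x y
  proof -
    have "((\<lambda>h. \<Sum>f\<leftarrow>fs. f (curve m x h) * f y) has_real_derivative (\<Sum>f\<leftarrow>fs. ?D f x * f y)) (at 0)"
      by (intro DERIV_sum_list DERIV_cmult_right DERIV_tderiv fs)
    then have 1: "((\<lambda>h. poly p (dot n (curve m x h) y)) has_real_derivative (\<Sum>f\<leftarrow>fs. ?D f x * f y)) (at 0)"
      by (rule DERIV_local_cong) (use u assms(2) in \<open>auto simp: fs(2) unit_vec_curve\<close>)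
    have 2: "((\<lambda>h. poly p (dot n (curve m x h) y)) has_real_derivative
        poly (pderiv p) (dot n (curve m x 0) y) * (y m - x m * dot n x y)) (at 0)"
      by (rule DERIV_chain2[OF poly_DERIV DERIV_curve_dot[OF assms(2)]])
    show ?thesis using DERIV_unique[OF 1 2] by simp
  qed
  \<comment> \<open>\<open>D1\<close> with the arguments exchanged gives the derivative in
    \<open>y\<close>; differentiating it along the curve through \<open>x\<close> gives the mixed
    derivative.\<close>
  have D2: "(\<Sum>f\<leftarrow>fs. ?D f x * ?D f y) = poly (pderiv (pderiv p)) (dot n x y)
        * ((y m - x m * dot n x y) * (x m - dot n x y * y m))
      + poly (pderiv p) (dot n x y) * (1 - x m * x m - (y m - x m * dot n x y) * y m)"
    if u: "unit_vec n x" "unit_vec n y" for x y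
  proof -
    have "((\<lambda>h. \<Sum>f\<leftarrow>fs. f (curve m x h) * ?D f y) has_real_derivative (\<Sum>f\<leftarrow>fs. ?D f x * ?D f y)) (at 0)"
      by (intro DERIV_sum_list DERIV_cmult_right DERIV_tderiv fs)
    then have 1: "((\<lambda>h. poly (pderiv p) (dot n (curve m x h) y)
         * (curve m x h m - y m * dot n (curve m x h) y))
         has_real_derivative (\<Sum>f\<leftarrow>fs. ?D f x * ?D f y)) (at 0)"
    proof (rule DERIV_local_cong)
      fix h :: real assume "\<bar>h\<bar> < 1"
      then have "unit_vec n (curve m x h)" using u assms(2) by (simp add: unit_vec_curve)
      from D1[OF u(2) this]
      show "(\<Sum>f\<leftarrow>fs. f (curve m x h) * ?D f y) = poly (pderiv p) (dot n (curve m x h) y)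
         * (curve m x h m - y m * dot n (curve m x h) y)"
        by (simp add: dot_sym[of y] mult.commute)
    qed
    have "((\<lambda>h. poly (pderiv p) (dot n (curve m x h) y)) has_real_derivative
        poly (pderiv (pderiv p)) (dot n (curve m x 0) y) * (y m - x m * dot n x y)) (at 0)"
      by (rule DERIV_chain2[OF poly_DERIV DERIV_curve_dot[OF assms(2)]])
    moreover have "((\<lambda>h. curve m x h m - y m * dot n (curve m x h) y) has_real_derivative
        ((if m = m then 1 else 0) - x m * x m) - y m * (y m - x m * dot n x y)) (at 0)"
      by (intro DERIV_diff DERIV_cmult DERIV_curve DERIV_curve_dot assms)
    ultimately have 2: "((\<lambda>h. poly (pderiv p) (dot n (curve m x h) y)
         * (curve m x h m - y m * dot n (curve m x h) y)) has_real_derivative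
         poly (pderiv (pderiv p)) (dot n (curve m x 0) y) * (y m - x m * dot n x y)
           * (curve m x 0 m - y m * dot n (curve m x 0) y)
         + (((if m = m then 1 else 0) - x m * x m) - y m * (y m - x m * dot n x y))
           * poly (pderiv p) (dot n (curve m x 0) y)) (at 0)"
      by (rule DERIV_mult)
    show ?thesis using DERIV_unique[OF 1 2] by (simp add: algebra_simps)
  qed
  \<comment> \<open>The new features. The minus sign is a product with -1 to match the closure rules
    of \<open>polyfun\<close>.\<close>
  let ?T = "\<lambda>f x. a * x m * f x + (-1) * ?D f x"
  have T: "(\<Sum>f\<leftarrow>map ?T fs. f x * f y) = (a\<^sup>2 * (x m * y m)) * (\<Sum>f\<leftarrow>fs. f x * f y)
      - (a * x m) * (\<Sum>f\<leftarrow>fs. ?D f y * f x) - (a * y m) * (\<Sum>f\<leftarrow>fs. ?D f x * f y)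
      + (\<Sum>f\<leftarrow>fs. ?D f x * ?D f y)" for x y
    by (induction fs) (auto simp: algebra_simps power2_eq_square)
  have poly_T: "\<forall>f\<in>set (map ?T fs). polyfun f"
    unfolding set_map by (intro ballI, elim imageE, hypsubst)
      (intro polyfun.intros polyfun_tderiv fs)
  show ?thesis unfolding gram_def
  proof (intro exI[of _ "map ?T fs"] conjI allI impI poly_T)
    fix x y assume u: "unit_vec n x" "unit_vec n y"
    show "(let t = dot n x y; p0 = poly p t; p1 = poly (pderiv p) t;
      p2 = poly (pderiv (pderiv p)) t in
      a\<^sup>2 * (x m * y m) * p0 - a * (x m * (x m - t * y m) + y m * (y m - t * x m)) * p1
      + (p2 * ((y m - t * x m) * (x m - t * y m)) + p1 * (1 - x m * x m - (y m - t * x m) * y m)))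
      = (\<Sum>f\<leftarrow>map ?T fs. f x * f y)"
      unfolding T D1[OF u] D1[OF u(2,1)] D2[OF u] fs(2)[OF u, symmetric] Let_def dot_sym[of y x]
      by (simp add: algebra_simps)
  qed
qed

section \<open>Gegenbauer polynomials\<close>

text \<open>The parameter \<open>v\<close> is the dimension of the ambient space minus 2, that is \<open>2\<lambda>\<close> in the usual
  notation for Gegenbauer polynomials; \<open>geg v k\<close> is normalised to be monic.\<close>

definition geg_beta :: "nat \<Rightarrow> nat \<Rightarrow> real" where
  "geg_beta v k = real k * (real k + real v - 1) / ((2 * real k + real v) * (2 * real k + real v - 2))"

fun geg :: "nat \<Rightarrow> nat \<Rightarrow> real poly" where
  "geg v 0 = 1"
| "geg v (Suc 0) = [:0, 1:]"
| "geg v (Suc (Suc k)) = [:0, 1:] * geg v (Suc k) - smult (geg_beta v (Suc k)) (geg v k)"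

section \<open>Recurrence, derivative formulas and differential equation\<close>

lemma geg_beta_Suc:
  "geg_beta v (Suc k)
     = (real k + 1) * (real k + v) / ((2 * real k + 2 + v) * (2 * real k + v))"
  by (simp add: geg_beta_def algebra_simps)

lemma geg_rec:
  assumes "v \<ge> 1"
  shows "(2 * real k + 2 + v) * (2 * real k + v) * poly (geg v (Suc (Suc k))) t
     = (2 * real k + 2 + v) * (2 * real k + v) * t * poly (geg v (Suc k)) t
       - (real k + 1) * (real k + v) * poly (geg v k) t"
proof -
  have nz: "2 * real k + 2 + v \<noteq> 0" "2 * real k + v \<noteq> 0" using assms by linarith+
  have b: "geg_beta v (Suc k) * ((2 * real k + 2 + v) * (2 * real k + v)) = (real k + 1) * (real k + v)"
    using nz by (simp add: geg_beta_Suc)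
  show ?thesis
    unfolding b[symmetric] by (simp add: algebra_simps)
qed

lemma geg_rec_pderiv:
  assumes "v \<ge> 1"
  shows "(2 * real k + 2 + v) * (2 * real k + v) * poly (pderiv (geg v (Suc (Suc k)))) t
     = (2 * real k + 2 + v) * (2 * real k + v)
         * (poly (geg v (Suc k)) t + t * poly (pderiv (geg v (Suc k))) t)
       - (real k + 1) * (real k + v) * poly (pderiv (geg v k)) t"
proof -
  have nz: "2 * real k + 2 + v \<noteq> 0" "2 * real k + v \<noteq> 0" using assms by linarith+
  have b: "geg_beta v (Suc k) * ((2 * real k + 2 + v) * (2 * real k + v)) = (real k + 1) * (real k + v)"
    using nz by (simp add: geg_beta_Suc)
  have X: "pderiv [:0, 1::real:] = 1" by (simp add: pderiv_pCons)
  show ?thesis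
    unfolding b[symmetric] geg.simps pderiv_diff pderiv_mult pderiv_smult X
    by (simp add: algebra_simps)
qed

text \<open>Two first-order relations share one induction because each is used in the step of the
  other. The step is elimination using the three-term recurrence and its derivative, followed by
  cancelling \<open>2 * K + V\<close>.\<close>

lemma geg_pderiv_aux:
  assumes "v \<ge> 1"
  shows "(1 - t\<^sup>2) * poly (pderiv (geg v k)) t
       = (real k + v) * t * poly (geg v k) t - (2 * real k + v) * poly (geg v (Suc k)) t \<and>
     (2 * real k + v) * poly (pderiv (geg v (Suc k))) t
       = (real k + 1) * (t * poly (pderiv (geg v k)) t + (real k + v) * poly (geg v k) t)"
proof (induction k)
  case 0
  then show ?case by (simp add: pderiv_pCons)
next
  case (Suc k)
  define q0 q1 q2 d0 d1 d2 where "q0 = poly (geg v k) t" and "q1 = poly (geg v (Suc k)) t"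
    and "q2 = poly (geg v (Suc (Suc k))) t" and "d0 = poly (pderiv (geg v k)) t"
    and "d1 = poly (pderiv (geg v (Suc k))) t" and "d2 = poly (pderiv (geg v (Suc (Suc k)))) t"
  define K V where "K = real k" and "V = real v"
  have nz: "2 * K + V \<noteq> 0" using assms by (simp add: K_def V_def)
  have A: "(1 - t\<^sup>2) * d0 = (K + V) * t * q0 - (2 * K + V) * q1"
    and E: "(2 * K + V) * d1 = (K + 1) * (t * d0 + (K + V) * q0)"
    using Suc by (simp_all add: q0_def q1_def d0_def d1_def K_def V_def)
  have R: "(2 * K + 2 + V) * (2 * K + V) * q2 = (2 * K + 2 + V) * (2 * K + V) * t * q1
       - (K + 1) * (K + V) * q0"
    using geg_rec[OF assms, of k t] by (simp add: q0_def q1_def q2_def K_def V_def)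
  have R': "(2 * K + 2 + V) * (2 * K + V) * d2 = (2 * K + 2 + V) * (2 * K + V) * (q1 + t * d1)
       - (K + 1) * (K + V) * d0"
    using geg_rec_pderiv[OF assms, of k t] by (simp add: d0_def d1_def q1_def d2_def K_def V_def)
  have "(2 * K + V) * ((1 - t\<^sup>2) * d1) = (2 * K + V) * ((K + 1 + V) * t * q1 - (2 * K + 2 + V) * q2)"
    using A E R by algebra
  then have A': "(1 - t\<^sup>2) * d1 = (K + 1 + V) * t * q1 - (2 * K + 2 + V) * q2"
    using nz by simp
  \<comment> \<open>This serves to eliminate \<open>d0\<close> from \<open>R'\<close>.\<close>
  have C: "(2 * K + V) * t * d1 - (K + 1) * d0 = (2 * K + V) * (K + 1) * q1"
    using A E by algebra
  have "(2 * K + V) * ((2 * K + 2 + V) * d2) = (2 * K + V) * ((K + 2) * (t * d1 + (K + 1 + V) * q1))"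
    using R' C by algebra
  then have E': "(2 * K + 2 + V) * d2 = (K + 2) * (t * d1 + (K + 1 + V) * q1)"
    using nz by simp
  have K: "real (Suc k) = K + 1" by (simp add: K_def)
  show ?case using A' E'
    unfolding q1_def[symmetric] q2_def[symmetric] d1_def[symmetric] d2_def[symmetric] K V_def[symmetric]
    by (simp add: add.commute add.left_commute)
qed

lemmas geg_pderiv = geg_pderiv_aux[THEN conjunct1]
  and geg_pderiv_Suc = geg_pderiv_aux[THEN conjunct2]

text \<open>Differentiate the first relation and remove the derivative of
  \<open>geg v (Suc k)\<close> by the second.\<close>

lemma geg_ode:
  assumes "v \<ge> 1"
  shows "(1 - t\<^sup>2) * poly (pderiv (pderiv (geg v k))) t
      = (real v + 1) * t * poly (pderiv (geg v k)) t - real k * (real k + v) * poly (geg v k) t"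
proof -
  have "[:1, 0, -1:] * pderiv (geg v k)
      = smult (real k + v) ([:0, 1:] * geg v k) - smult (2 * real k + v) (geg v (Suc k))"
    unfolding poly_eq_poly_eq_iff[symmetric] fun_eq_iff
    using geg_pderiv[OF assms] by (simp add: power2_eq_square algebra_simps)
  then have e: "poly (pderiv ([:1, 0, -1:] * pderiv (geg v k))) t
      = poly (pderiv (smult (real k + v) ([:0, 1:] * geg v k) - smult (2 * real k + v) (geg v (Suc k)))) t"
    by simp
  have X: "pderiv [:1, 0, -1::real:] = [:0, -2:]" "pderiv [:0, 1::real:] = 1"
    by (simp_all add: pderiv_pCons)
  have "(1 - t\<^sup>2) * poly (pderiv (pderiv (geg v k))) t - 2 * t * poly (pderiv (geg v k)) t
     = (real k + v) * (poly (geg v k) t + t * poly (pderiv (geg v k)) t)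
       - (2 * real k + v) * poly (pderiv (geg v (Suc k))) t"
    using e unfolding pderiv_diff pderiv_mult pderiv_smult X
    by (simp add: power2_eq_square algebra_simps)
  then show ?thesis unfolding geg_pderiv_Suc[OF assms] by algebra
qed

text \<open>One direction of Schoenberg's theorem. Summing the raised kernels over all coordinates
  leaves a function of the inner product alone; the differential equation removes its second
  derivative, and \<open>geg_pderiv\<close> turns the rest into \<open>(2 * k + v)\<^sup>2\<close>
  times the next polynomial.\<close>

lemma gram_geg:
  assumes "v \<ge> 1"
  shows "gram (v + 2) (\<lambda>x y. poly (geg v k) (dot (v + 2) x y))"
proof (induction k)
  case 0
  show ?case unfolding gram_def
    by (rule exI[of _ "[\<lambda>x. 1]"]) (auto intro: polyfun.const)
next
  case (Suc k)
  let ?n = "v + 2" and ?p = "geg v k" and ?a = "real k + real v"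
  let ?c = "(2 * real k + v)\<^sup>2"
  have c: "?c > 0" using assms by auto
  have "gram ?n (\<lambda>x y. inverse ?c * (\<Sum>m<?n. let t = dot ?n x y; p0 = poly ?p t; p1 = poly (pderiv ?p) t;
      p2 = poly (pderiv (pderiv ?p)) t in
      ?a\<^sup>2 * (x m * y m) * p0 - ?a * (x m * (x m - t * y m) + y m * (y m - t * x m)) * p1
      + (p2 * ((y m - t * x m) * (x m - t * y m)) + p1 * (1 - x m * x m - (y m - t * x m) * y m))))"
    (is "gram _ (\<lambda>x y. _ * (\<Sum>m<?n. ?F x y m))")
    using c by (intro gram_scale gram_sum gram_raise Suc) auto
  then show ?case
  proof (rule gram_cong)
    fix x y assume u: "unit_vec ?n x" "unit_vec ?n y"
    define t where "t = dot ?n x y"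
    define p0 p1 p2 where "p0 = poly ?p t" and "p1 = poly (pderiv ?p) t" and "p2 = poly (pderiv (pderiv ?p)) t"
    have s: "(\<Sum>m<?n. x m * x m) = 1" "(\<Sum>m<?n. y m * y m) = 1" "(\<Sum>m<?n. x m * y m) = t"
      using u by (simp_all only: unit_vec_def dot_def t_def)
    have "(\<Sum>m<?n. ?F x y m) = (\<Sum>m<?n. p1 + (?a\<^sup>2 * p0 + 2 * ?a * t * p1 + p2 * (1 + t\<^sup>2) + p1 * t) * (x m * y m)
        + (- ?a * p1 - p2 * t - p1) * (x m * x m) + (- ?a * p1 - p2 * t - p1) * (y m * y m))"
      unfolding t_def[symmetric] Let_def p0_def[symmetric] p1_def[symmetric] p2_def[symmetric]
      by (rule sum.cong[OF refl]) (simp add: power2_eq_square algebra_simps)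
    also have "\<dots> = ?n * p1 + (?a\<^sup>2 * p0 + 2 * ?a * t * p1 + p2 * (1 + t\<^sup>2) + p1 * t) * t
        + (- ?a * p1 - p2 * t - p1) + (- ?a * p1 - p2 * t - p1)"
      unfolding sum.distrib sum_distrib_left[symmetric] s by simp
    also have "\<dots> = ?a\<^sup>2 * t * p0 - 2 * ?a * (1 - t\<^sup>2) * p1 - t * ((1 - t\<^sup>2) * p2) + (real v + t\<^sup>2) * p1"
      by (simp add: power2_eq_square algebra_simps)
    also have "\<dots> = (2 * real k + v) * (?a * t * p0 - (1 - t\<^sup>2) * p1)"
      unfolding p2_def geg_ode[OF assms] p1_def[symmetric] p0_def[symmetric] by algebra
    also have "\<dots> = ?c * poly (geg v (Suc k)) t"
      unfolding p1_def geg_pderiv[OF assms] p0_def[symmetric] by algebra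
    finally show "inverse ?c * (\<Sum>m<?n. ?F x y m) = poly (geg v (Suc k)) (dot ?n x y)"
      using c by (simp only: t_def) simp
  qed
qed

text \<open>For positive \<open>k\<close>, after cancelling \<open>2 * k + v\<close> and clearing
  denominators, the sides differ by exactly \<open>v * (v - 2)\<close>.\<close>

lemma geg_beta_mono:
  assumes "v \<ge> 2"
  shows "geg_beta v k \<le> geg_beta v (Suc k)"
proof (cases k)
  case 0
  then show ?thesis using assms by (simp add: geg_beta_def)
next
  case (Suc l)
  define L V where "L = real l" and "V = real v - 2"
  have nn: "L \<ge> 0" "V \<ge> 0" using assms by (simp_all add: L_def V_def)
  have k: "real k = L + 1" "real v = V + 2" "real (Suc k) = L + 2" by (simp_all add: Suc L_def V_def)
  have "0 \<le> V\<^sup>2 + 2 * V" using nn by simp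
  then have "(L + 1) * (L + V + 2) * (2 * L + V + 6) \<le> (L + 2) * (L + V + 3) * (2 * L + V + 2)"
    by (simp add: power2_eq_square algebra_simps)
  then have "(L + 1) * (L + V + 2) / (2 * L + V + 2) \<le> (L + 2) * (L + V + 3) / (2 * L + V + 6)"
    using nn by (simp add: divide_simps)
  then have "(L + 1) * (L + V + 2) / (2 * L + V + 2) / (2 * L + V + 4)
      \<le> (L + 2) * (L + V + 3) / (2 * L + V + 6) / (2 * L + V + 4)"
    using nn by (intro divide_right_mono) auto
  then show ?thesis unfolding geg_beta_def k
    by (simp add: add.commute add.left_commute mult.commute algebra_simps)
qed

section \<open>The linear programming bound\<close>

text \<open>The squared norm of \<open>geg v k\<close> for the normalised Gegenbauer weight, and so
  the constant term in the expansion of its square.\<close>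

definition geg_H :: "nat \<Rightarrow> nat \<Rightarrow> real" where
  "geg_H v k = (\<Prod>i<k. geg_beta v (Suc i))"

definition code_sum :: "nat \<Rightarrow> 'a set \<Rightarrow> ('a \<Rightarrow> nat \<Rightarrow> real) \<Rightarrow> real poly \<Rightarrow> real" where
  "code_sum n I x p = (\<Sum>i\<in>I. \<Sum>j\<in>I. poly p (dot n (x i) (x j)))"

section \<open>Sums over the ordered pairs of a code as a functional on polynomials\<close>

lemma code_sum_add: "code_sum n I x (p + q) = code_sum n I x p + code_sum n I x q"
  by (simp add: code_sum_def sum.distrib)

lemma code_sum_diff: "code_sum n I x (p - q) = code_sum n I x p - code_sum n I x q"
  by (simp add: code_sum_def sum_subtractf)

lemma code_sum_smult: "code_sum n I x (smult c p) = c * code_sum n I x p"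
  by (simp add: code_sum_def sum_distrib_left)

lemma code_sum_sum: "finite A \<Longrightarrow> code_sum n I x (\<Sum>a\<in>A. f a) = (\<Sum>a\<in>A. code_sum n I x (f a))"
  by (induction A rule: finite_induct) (simp_all add: code_sum_add, simp add: code_sum_def)

text \<open>Schur's product theorem: products of features represent the product kernel, and the
  double sum becomes a sum of squares.\<close>

lemma code_sum_gram_mult_nonneg:
  assumes "gram n (\<lambda>x y. poly p (dot n x y))" "gram n (\<lambda>x y. poly q (dot n x y))"
    and "\<And>i. i \<in> I \<Longrightarrow> unit_vec n (x i)"
  shows "code_sum n I x (p * q) \<ge> 0"
proof -
  obtain fs gs where
     fs: "\<And>x y. unit_vec n x \<Longrightarrow> unit_vec n y \<Longrightarrow> poly p (dot n x y) = (\<Sum>f\<leftarrow>fs. f x * f y)" and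
     gs: "\<And>x y. unit_vec n x \<Longrightarrow> unit_vec n y \<Longrightarrow> poly q (dot n x y) = (\<Sum>f\<leftarrow>gs. f x * f y)"
    using assms(1,2) unfolding gram_def by blast
  have "code_sum n I x (p * q) = (\<Sum>i\<in>I. \<Sum>j\<in>I. (\<Sum>f\<leftarrow>fs. \<Sum>g\<leftarrow>gs. (f (x i) * g (x i)) * (f (x j) * g (x j))))"
  proof -
    have pr: "sum_list (map F fs) * sum_list (map G gs) = (\<Sum>f\<leftarrow>fs. \<Sum>g\<leftarrow>gs. F f * G g)"
      for F G :: "((nat \<Rightarrow> real) \<Rightarrow> real) \<Rightarrow> real"
      by (induction fs) (simp_all add: algebra_simps sum_list_const_mult)
    show ?thesis unfolding code_sum_def
      by (intro sum.cong refl) (simp add: fs gs assms(3) pr ac_simps)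
  qed
  also have "\<dots> = (\<Sum>f\<leftarrow>fs. \<Sum>g\<leftarrow>gs. (\<Sum>i\<in>I. \<Sum>j\<in>I. (f (x i) * g (x i)) * (f (x j) * g (x j))))"
  proof -
    have sw: "(\<Sum>i\<in>I. \<Sum>f\<leftarrow>hs. F i f) = (\<Sum>f\<leftarrow>hs. \<Sum>i\<in>I. F i f)" for hs and F :: "'a \<Rightarrow> ((nat \<Rightarrow> real) \<Rightarrow> real) \<Rightarrow> real"
      by (induction hs) (simp_all add: sum.distrib)
    show ?thesis by (simp add: sw)
  qed
  also have "\<dots> = (\<Sum>f\<leftarrow>fs. \<Sum>g\<leftarrow>gs. (\<Sum>i\<in>I. f (x i) * g (x i))\<^sup>2)"
    by (simp add: power2_eq_square sum_product)
  also have "\<dots> \<ge> 0" by (intro sum_list_nonneg) (auto intro!: sum_list_nonneg)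
  finally show ?thesis .
qed

lemma code_sum_geg_mult_nonneg:
  assumes "v \<ge> 1" "\<And>i. i \<in> I \<Longrightarrow> unit_vec (v + 2) (x i)"
  shows "code_sum (v + 2) I x (geg v k * geg v l) \<ge> 0"
  using assms by (intro code_sum_gram_mult_nonneg gram_geg) auto

text \<open>The monotonicity of \<open>\<beta>\<close> turns this identity into a lower bound for the constant term of
  \<open>q\<^sub>k\<^sup>2\<close> in the order given by positive definiteness, without computing linearisation
  coefficients.\<close>

lemma geg_turan_Suc:
  "geg v (k + 2) * geg v (k + 2) - geg v (k + 1) * geg v (k + 3)
     = smult (geg_beta v (k + 2) - geg_beta v (k + 1)) (geg v (k + 1) * geg v (k + 1))
       + smult (geg_beta v (k + 1)) (geg v (k + 1) * geg v (k + 1) - geg v k * geg v (k + 2))"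
proof -
  define X where "X = [:0, 1::real:]"
  have 2: "geg v (k + 2) = X * geg v (k + 1) - smult (geg_beta v (k + 1)) (geg v k)"
    by (simp add: X_def)
  have 3: "geg v (k + 3) = X * geg v (k + 2) - smult (geg_beta v (k + 2)) (geg v (k + 1))"
    by (simp add: X_def eval_nat_numeral)
  have "geg v (k + 2) * geg v (k + 2) - geg v (k + 1) * geg v (k + 3)
     = geg v (k + 2) * (X * geg v (k + 1) - smult (geg_beta v (k + 1)) (geg v k))
       - geg v (k + 1) * (X * geg v (k + 2) - smult (geg_beta v (k + 2)) (geg v (k + 1)))"
    using 2 3 by presburger
  also have "\<dots> = smult (geg_beta v (k + 2) - geg_beta v (k + 1)) (geg v (k + 1) * geg v (k + 1))
       + smult (geg_beta v (k + 1)) (geg v (k + 1) * geg v (k + 1) - geg v k * geg v (k + 2))"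
  proof -
    have "q2 * (X * q1 - smult b1 q0) - q1 * (X * q2 - smult b2 q1)
        = smult (b2 - b1) (q1 * q1) + smult b1 (q1 * q1 - q0 * q2)" for q0 q1 q2 b1 b2
      by (simp add: algebra_simps smult_diff_left smult_diff_right)
    then show ?thesis .
  qed
  finally show ?thesis .
qed

text \<open>The square is bounded jointly with the Turan difference. The next square is that
  difference plus a product with nonnegative sum; the next difference is, by
  \<open>geg_turan_Suc\<close>, a nonnegative combination of that square and the old
  difference.\<close>

lemma code_sum_geg_square:
  assumes v: "v \<ge> 2" and x: "\<And>i. i \<in> I \<Longrightarrow> unit_vec (v + 2) (x i)"
  shows "code_sum (v + 2) I x (geg v k * geg v k) \<ge> geg_H v k * (real (card I))\<^sup>2"
proof -
  let ?S = "code_sum (v + 2) I x" and ?N = "(real (card I))\<^sup>2"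
  have "?S (geg v k * geg v k) \<ge> geg_H v k * ?N \<and>
     ?S (geg v (k + 1) * geg v (k + 1) - geg v k * geg v (k + 2)) \<ge> geg_H v (k + 1) * ?N"
  proof (induction k)
    case 0
    have "geg v (0 + 1) * geg v (0 + 1) - geg v 0 * geg v (0 + 2) = smult (geg_beta v 1) 1"
      by (simp add: eval_nat_numeral)
    moreover have 1: "?S 1 = ?N" by (simp add: code_sum_def power2_eq_square)
    ultimately have "?S (geg v (0 + 1) * geg v (0 + 1) - geg v 0 * geg v (0 + 2)) = geg_beta v 1 * ?N"
      by (simp only: code_sum_smult)
    moreover have "geg_H v 0 * ?N \<le> ?S (geg v 0 * geg v 0)"
      using 1 by (simp add: geg_H_def)
    ultimately show ?case by (simp only: geg_H_def) simp
  next
    case (Suc k)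
    have "?S (geg v (k + 1) * geg v (k + 1))
       = ?S (geg v k * geg v (k + 2)) + ?S (geg v (k + 1) * geg v (k + 1) - geg v k * geg v (k + 2))"
      by (simp add: code_sum_add[symmetric])
    moreover have "?S (geg v k * geg v (k + 2)) \<ge> 0"
      using v x by (intro code_sum_geg_mult_nonneg) auto
    ultimately have 1: "?S (geg v (k + 1) * geg v (k + 1)) \<ge> geg_H v (k + 1) * ?N"
      using Suc by linarith
    have b: "geg_beta v (k + 2) - geg_beta v (k + 1) \<ge> 0" "geg_beta v (k + 1) \<ge> 0"
      using geg_beta_mono[OF v, of "Suc k"] by (simp_all add: geg_beta_Suc)
    \<comment> \<open>Splits the last factor \<open>geg_beta v (k + 2)\<close> to match the two
      terms of \<open>geg_turan_Suc\<close>.\<close>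
    have "geg_H v (k + 2) * ?N = (geg_beta v (k + 2) - geg_beta v (k + 1)) * (geg_H v (k + 1) * ?N)
        + geg_beta v (k + 1) * (geg_H v (k + 1) * ?N)"
      by (simp add: geg_H_def algebra_simps)
    also have "\<dots> \<le> (geg_beta v (k + 2) - geg_beta v (k + 1)) * ?S (geg v (k + 1) * geg v (k + 1))
        + geg_beta v (k + 1) * ?S (geg v (k + 1) * geg v (k + 1) - geg v k * geg v (k + 2))"
      using 1 Suc b by (intro add_mono mult_left_mono) auto
    also have "\<dots> = ?S (geg v (k + 2) * geg v (k + 2) - geg v (k + 1) * geg v (k + 3))"
      unfolding geg_turan_Suc code_sum_add code_sum_smult ..
    finally show ?case using 1 by (simp add: eval_nat_numeral)
  qed
  then show ?thesis by simp
qed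

section \<open>Values at 1 and dimensions of spaces of spherical harmonics\<close>

lemma geg_at_1_Suc:
  assumes "v \<ge> 1"
  shows "(2 * real k + v) * poly (geg v (Suc k)) 1 = (real k + v) * poly (geg v k) 1"
  using geg_pderiv[OF assms, of 1 k] by simp

lemma geg_at_1_pos:
  assumes "v \<ge> 1"
  shows "poly (geg v k) 1 > 0"
proof (induction k)
  case (Suc k)
  have "(2 * real k + v) * poly (geg v (Suc k)) 1 > 0"
    unfolding geg_at_1_Suc[OF assms] using Suc assms by simp
  then show ?case using assms by (simp add: zero_less_mult_iff)
qed simp

lemma geg_at_1_antimono:
  assumes "v \<ge> 1" "k \<le> l"
  shows "poly (geg v l) 1 \<le> poly (geg v k) 1"
  using assms(2)
proof (induction l rule: dec_induct)
  case (step l)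
  have "(2 * real l + v) * poly (geg v (Suc l)) 1 \<le> (2 * real l + v) * poly (geg v l) 1"
    unfolding geg_at_1_Suc[OF assms(1)] using geg_at_1_pos[OF assms(1), of l]
    by (intro mult_right_mono) auto
  then have "poly (geg v (Suc l)) 1 \<le> poly (geg v l) 1"
    using assms(1) by simp
  then show ?case using step by linarith
qed simp

lemma geg_H_pos:
  assumes "v \<ge> 1" shows "geg_H v k > 0"
  unfolding geg_H_def geg_beta_Suc using assms
  by (intro prod_pos) (auto intro!: divide_pos_pos mult_pos_pos)

text \<open>The squared value at 1 divided by \<open>geg_H v k\<close> is the dimension of the
  harmonics of degree \<open>k\<close> in \<open>v + 2\<close> variables. All factors satisfy
  first-order recursions in \<open>k\<close>.\<close>

lemma geg_at_1_square:
  assumes "v \<ge> 1"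
  shows "(poly (geg v k) 1)\<^sup>2 * v = (2 * real k + v) * real ((k + v - 1) choose k) * geg_H v k"
proof (induction k)
  case 0
  show ?case by (simp add: geg_H_def)
next
  case (Suc k)
  define B B' H q q' K V where "B = real ((k + v - 1) choose k)" and "B' = real ((Suc k + v - 1) choose Suc k)"
    and "H = geg_H v k" and "q = poly (geg v k) 1" and "q' = poly (geg v (Suc k)) 1"
    and "K = real k" and "V = real v"
  have nz: "2 * K + V > 0" "V > 0" "K \<ge> 0" using assms by (simp_all add: K_def V_def)
  have e: "Suc (k + v - 1) = k + v" using assms by simp
  have "real (Suc k * ((k + v) choose Suc k)) = real ((k + v) * ((k + v - 1) choose k))"
    using Suc_times_binomial[of k "k + v - 1"] unfolding e by (rule arg_cong)
  then have BB: "(K + 1) * B' = (K + V) * B"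
    unfolding of_nat_mult by (simp add: B_def B'_def K_def V_def add.commute)
  have qq: "(2 * K + V) * q' = (K + V) * q"
    using geg_at_1_Suc[OF assms, of k] by (simp add: q_def q'_def K_def V_def)
  have HH: "geg_H v (Suc k) = H * ((K + 1) * (K + V) / ((2 * K + 2 + V) * (2 * K + V)))"
    by (simp add: geg_H_def H_def K_def V_def geg_beta_Suc)
  have IH: "q\<^sup>2 * V = (2 * K + V) * B * H"
    using Suc by (simp add: B_def H_def q_def K_def V_def)
  have "(2 * K + V)\<^sup>2 * (q'\<^sup>2 * V) = (K + V)\<^sup>2 * ((2 * K + V) * B * H)"
    using qq IH by algebra
  also have "\<dots> = (2 * K + V)\<^sup>2 * ((K + V) * ((K + V) * B) * H / (2 * K + V))"
    using nz by (simp add: power2_eq_square)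
  finally have "q'\<^sup>2 * V = (K + V) * ((K + 1) * B') * H / (2 * K + V)"
    unfolding BB using nz by (subst (asm) mult_cancel_left) simp
  also have "\<dots> = (2 * K + 2 + V) * B' * (H * ((K + 1) * (K + V) / ((2 * K + 2 + V) * (2 * K + V))))"
  proof -
    have "(K + V) * ((K + 1) * B') * H / P = Q * B' * (H * ((K + 1) * (K + V) / (Q * P)))"
      if "P \<noteq> 0" "Q \<noteq> 0" for P Q using that by simp
    then show ?thesis using nz by auto
  qed
  finally show ?case unfolding HH q'_def B'_def K_def V_def by (simp add: add.commute)
qed

text \<open>On the range of indices used, \<open>\<beta>\<^sub>k\<close> is close to \<open>54/841\<close>, and \<open>395/100\<close> approximates
  \<open>1 / \<surd>\<beta>\<^sub>k\<close>, the factor that symmetrises the recurrence. The sine is the top eigenvector of a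
  path with 49 vertices, with eigenvalue \<open>2 cos (\<pi>/50)\<close>; the length 50 is what makes this large
  enough.\<close>

definition window :: "nat \<Rightarrow> real" where
  "window a = (395/100) ^ a * sin (real a * (pi / 50))"

lemma window_0 [simp]: "window 0 = 0" and window_50 [simp]: "window 50 = 0"
  by (simp_all add: window_def)

lemma sin_window_nonneg: "a \<le> 50 \<Longrightarrow> sin (real a * (pi / 50)) \<ge> 0"
  by (rule sin_ge_zero) (auto simp: field_simps)

lemma window_nonneg: "a \<le> 50 \<Longrightarrow> window a \<ge> 0"
  using sin_window_nonneg by (simp add: window_def)

lemma window_1_pos: "window 1 > 0"
  using sin_gt_zero[of "pi / 50"] pi_gt_zero by (simp add: window_def)

lemma cos_pi_50: "cos (pi / 50) \<ge> 996/1000"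
proof -
  have "\<bar>sin (pi / 100)\<bar> \<le> pi / 100"
    using abs_sin_x_le_abs_x[of "pi / 100"] by simp
  then have "\<bar>sin (pi / 100)\<bar> \<le> 4 / 100" using pi_less_4 by linarith
  then have "(sin (pi / 100))\<^sup>2 \<le> (4 / 100)\<^sup>2" by (simp add: abs_le_square_iff[symmetric])
  moreover have "cos (pi / 50) = 1 - 2 * (sin (pi / 100))\<^sup>2"
    using cos_double_sin[of "pi / 100"] by simp
  ultimately show ?thesis by (simp add: power2_eq_square)
qed

lemma window_eigen:
  assumes "a < 49" "b \<ge> 641/10000"
  shows "window a + b * window (a + 2) - window (a + 1) / 2 \<ge> 3/1000 * window (a + 1)"
proof -
  define \<theta> where "\<theta> = pi / 50"
  define s0 s1 s2 :: real where "s0 = sin (real a * \<theta>)" and "s1 = sin (real (a + 1) * \<theta>)" and "s2 = sin (real (a + 2) * \<theta>)"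
  have nn: "s0 \<ge> 0" "s1 \<ge> 0" "s2 \<ge> 0"
    using assms(1) unfolding s0_def s1_def s2_def \<theta>_def by (intro sin_window_nonneg; simp)+
  have "s0 + s2 = sin (real (a + 1) * \<theta> - \<theta>) + sin (real (a + 1) * \<theta> + \<theta>)"
    by (simp add: s0_def s2_def algebra_simps)
  also have "\<dots> = 2 * cos \<theta> * s1" by (simp add: sin_add sin_diff s1_def)
  finally have s: "s0 + s2 = 2 * cos \<theta> * s1" .
  have "2 * (996/1000) * s1 \<le> s0 + s2"
    unfolding s using cos_pi_50 nn by (intro mult_right_mono) (auto simp: \<theta>_def)
  \<comment> \<open>\<open>253/1000\<close> is below both \<open>100/395\<close> and
    \<open>641/10000 * 395/100\<close>; multiplied by \<open>2 * (996/1000)\<close> it still exceeds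
    \<open>503/1000 = 1/2 + 3/1000\<close>.\<close>
  then have "503/1000 * s1 \<le> 253/1000 * s0 + 253/1000 * s2" using nn by linarith
  also have "\<dots> \<le> 100/395 * s0 + (b * (395/100)) * s2"
    using nn assms(2) by (intro add_mono mult_right_mono) auto
  finally have "503/1000 * s1 \<le> 100/395 * s0 + (b * (395/100)) * s2" .
  then have "(395/100) ^ (a + 1) * (503/1000 * s1) \<le> (395/100) ^ (a + 1) * (100/395 * s0 + (b * (395/100)) * s2)"
    by (rule mult_left_mono) simp
  then show ?thesis unfolding window_def \<theta>_def[symmetric] s0_def[symmetric] s1_def[symmetric] s2_def[symmetric]
    by (simp add: algebra_simps)
qed

text \<open>Monotonicity reduces this to \<open>k = 2 * m\<close>, where the value tends to
  \<open>54/841\<close> as \<open>m\<close> grows; the bound is slightly smaller, since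
  \<open>641 * 841 < 540000\<close>.\<close>

lemma geg_beta_ge:
  assumes "m \<ge> 1" "k \<ge> 2 * m"
  shows "geg_beta (25 * m - 2) k \<ge> 641/10000"
  using assms(2)
proof (induction k rule: dec_induct)
  case base
  define M where "M = real m"
  have M: "M \<ge> 1" "real (25 * m - 2) = 25 * M - 2" using assms(1) by (simp_all add: M_def of_nat_diff)
  have "0 \<le> M * M" by simp
  then have "641 * ((29 * M - 2) * (29 * M - 4)) \<le> 10000 * (2 * M * (27 * M - 3))"
    using M(1) by (simp add: algebra_simps; linarith)
  moreover have "(29 * M - 2) * (29 * M - 4) > 0" using M by simp
  ultimately have "2 * M * (27 * M - 3) / ((29 * M - 2) * (29 * M - 4)) \<ge> 641 / 10000"
    by (simp add: pos_le_divide_eq)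
  moreover have "geg_beta (25 * m - 2) (2 * m) = 2 * M * (27 * M - 3) / ((29 * M - 2) * (29 * M - 4))"
    unfolding geg_beta_def M(2) by (simp add: M_def algebra_simps)
  ultimately show ?case by simp
next
  case (step k)
  have "25 * m - 2 \<ge> 2" using assms(1) by simp
  from geg_beta_mono[OF this, of k] step show ?case by linarith
qed

text \<open>The constant left when the lower bound
  \<open>3/1000 * (window 1)\<^sup>2 * H * N\<^sup>2\<close> and the upper bound
  \<open>N * (W * q)\<^sup>2 / 2\<close> for a code sum are compared.\<close>

definition code_const :: real where
  "code_const = (\<Sum>a<49. window (Suc a))\<^sup>2 / (6/1000 * (window 1)\<^sup>2)"

text \<open>The test polynomial is nonpositive at off-diagonal inner products, so its code sum is at
  most \<open>card I\<close> times its value at 1. The eigenvector inequality bounds the same sum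
  below by a multiple of \<open>(card I)\<^sup>2\<close>.\<close>

lemma spherical_code_card_geg:
  fixes x :: "'a \<Rightarrow> nat \<Rightarrow> real"
  assumes m: "m \<ge> 1" and fin: "finite I"
    and unit: "\<And>i. i \<in> I \<Longrightarrow> unit_vec (25 * m) (x i)"
    and sep: "\<And>i j. i \<in> I \<Longrightarrow> j \<in> I \<Longrightarrow> i \<noteq> j \<Longrightarrow> dot (25 * m) (x i) (x j) \<le> 1/2"
  shows "real (card I) * geg_H (25 * m - 2) (2 * m) \<le> code_const * (poly (geg (25 * m - 2) (2 * m)) 1)\<^sup>2"
proof -
  define v where "v = 25 * m - 2"
  \<comment> \<open>One less than the lowest degree \<open>2 * m\<close> in \<open>g\<close>, so
    that index 0 falls on the zero weight \<open>window 0\<close>.\<close>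
  define b where "b = 2 * m - 1"
  have v2: "v \<ge> 2" "v \<ge> 1" and v: "v + 2 = 25 * m" using m by (simp_all add: v_def)
  have b1: "b \<ge> 1" "Suc b = 2 * m" using m by (simp_all add: b_def)
  have u: "\<And>i. i \<in> I \<Longrightarrow> unit_vec (v + 2) (x i)" using unit v by simp
  let ?S = "code_sum (v + 2) I x" and ?N = "real (card I)"
  let ?q = "geg v"
  have beta: "geg_beta v (b + a + 2) \<ge> 641/10000" for a
    unfolding v_def b_def by (rule geg_beta_ge) (use m in auto)
  define g where "g = (\<Sum>a<49. smult (window (Suc a)) (?q (b + Suc a)))"
  define \<Phi> where "\<Phi> a = ?S (?q (b + a) * g)" for a
  have \<Phi>_eq: "\<Phi> a = (\<Sum>c<49. window (Suc c) * ?S (?q (b + a) * ?q (b + Suc c)))" for a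
    unfolding \<Phi>_def g_def sum_distrib_left mult_smult_right by (simp add: code_sum_sum code_sum_smult)
  have terms: "window (Suc c) * ?S (?q (b + a) * ?q (b + Suc c)) \<ge> 0" if "c < 49" for a c
    using that window_nonneg code_sum_geg_mult_nonneg[OF v2(2) u] by (intro mult_nonneg_nonneg) auto
  have \<Phi>_nonneg: "\<Phi> a \<ge> 0" for a
    unfolding \<Phi>_eq by (intro sum_nonneg terms) auto
  \<comment> \<open>Only the summand with the square of the lowest polynomial is kept from
    \<open>\<Phi> 1\<close>.\<close>
  have "window 1 * ?S (?q (b + 1) * ?q (b + 1)) \<le> \<Phi> 1"
    unfolding \<Phi>_eq using member_le_sum[of 0 "{..<49}" "\<lambda>c. window (Suc c) * ?S (?q (b + 1) * ?q (b + Suc c))"]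
      terms[of _ 1] by auto
  moreover have "window 1 * (geg_H v (b + 1) * ?N\<^sup>2) \<le> window 1 * ?S (?q (b + 1) * ?q (b + 1))"
    using window_1_pos by (intro mult_left_mono code_sum_geg_square[OF v2(1) u]) auto
  ultimately have \<Phi>1: "window 1 * (geg_H v (b + 1) * ?N\<^sup>2) \<le> \<Phi> 1" by linarith
  define f where "f = [:-1/2, 1:] * g * g"
  have step: "?S ([:-1/2, 1:] * ?q (b + Suc a) * g)
      = \<Phi> (Suc (Suc a)) + geg_beta v (b + Suc a) * \<Phi> a - \<Phi> (Suc a) / 2" for a
  proof -
    have "[:-1/2, 1:] * ?q (b + Suc a) = ?q (b + Suc (Suc a)) + smult (geg_beta v (b + Suc a)) (?q (b + a))
        - smult (1/2) (?q (b + Suc a))"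
      by simp
    then show ?thesis
      by (simp only: distrib_right left_diff_distrib code_sum_add code_sum_diff mult_smult_left
          code_sum_smult \<Phi>_def)
  qed
  have "?S f = ?S (\<Sum>a<49. smult (window (Suc a)) ([:-1/2, 1:] * ?q (b + Suc a) * g))"
  proof -
    have "f = [:-1/2, 1:] * (\<Sum>a<49. smult (window (Suc a)) (?q (b + Suc a))) * g"
      unfolding f_def by (subst (1) g_def) (rule refl)
    then show ?thesis
      by (simp only: sum_distrib_left sum_distrib_right mult_smult_right mult_smult_left)
  qed
  also have "\<dots> = (\<Sum>a<49. window (Suc a) * (\<Phi> (Suc (Suc a)) + geg_beta v (b + Suc a) * \<Phi> a - \<Phi> (Suc a) / 2))"
    by (simp only: code_sum_sum code_sum_smult step finite_lessThan)
  also have "\<dots> = (\<Sum>a<49. window (Suc a) * \<Phi> (Suc (Suc a)))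
      + (\<Sum>a<49. geg_beta v (b + Suc a) * window (Suc a) * \<Phi> a) - (\<Sum>a<49. window (Suc a) * \<Phi> (Suc a) / 2)"
    by (simp add: sum.distrib[symmetric] sum_subtractf[symmetric] algebra_simps)
  finally have Sf: "?S f = (\<Sum>a<49. window (Suc a) * \<Phi> (Suc (Suc a)))
      + (\<Sum>a<49. geg_beta v (b + Suc a) * window (Suc a) * \<Phi> a) - (\<Sum>a<49. window (Suc a) * \<Phi> (Suc a) / 2)" .
  have "3/1000 * window 1 * \<Phi> 1 \<le> (\<Sum>a<49. (3/1000 * window (a + 1)) * \<Phi> (Suc a))"
    using member_le_sum[of 0 "{..<49}" "\<lambda>a. (3/1000 * window (a + 1)) * \<Phi> (Suc a)"] \<Phi>_nonneg window_nonneg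
    by (auto intro!: mult_nonneg_nonneg)
  also have "\<dots> \<le> (\<Sum>a<49. (window a + geg_beta v (b + a + 2) * window (a + 2) - window (a + 1) / 2) * \<Phi> (Suc a))"
    using \<Phi>_nonneg beta by (intro sum_mono mult_right_mono window_eigen) auto
  also have "\<dots> = (\<Sum>a<49. window a * \<Phi> (Suc a))
      + (\<Sum>a<49. geg_beta v (b + Suc (Suc a)) * window (Suc (Suc a)) * \<Phi> (Suc a)) - (\<Sum>a<49. window (Suc a) * \<Phi> (Suc a) / 2)"
    by (simp add: sum.distrib[symmetric] sum_subtractf[symmetric] algebra_simps)
  also have "\<dots> \<le> ?S f"
  proof -
    \<comment> \<open>Multiplication by \<open>t\<close> spills onto degrees \<open>b\<close> and
      \<open>b + 50\<close>, just outside the window. These contributions are nonnegative and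
      dropped; as \<open>window 0\<close> and \<open>window 50\<close> vanish, the re-indexed sums
      otherwise agree.\<close>
    define h where "h a = geg_beta v (b + Suc a) * window (Suc a) * \<Phi> a" for a
    have "(\<Sum>a<Suc 49. window a * \<Phi> (Suc a)) = (\<Sum>a<49. window (Suc a) * \<Phi> (Suc (Suc a)))"
      by (subst sum.lessThan_Suc_shift) simp
    moreover have "window 49 * \<Phi> (Suc 49) \<ge> 0" using window_nonneg \<Phi>_nonneg by simp
    ultimately have 1: "(\<Sum>a<49. window a * \<Phi> (Suc a)) \<le> (\<Sum>a<49. window (Suc a) * \<Phi> (Suc (Suc a)))"
      by (simp only: sum.lessThan_Suc)
    have "(\<Sum>a<Suc 49. h a) = h 0 + (\<Sum>a<49. h (Suc a))"
      by (rule sum.lessThan_Suc_shift)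
    moreover have "h 49 = 0" by (simp add: h_def)
    moreover have "h 0 \<ge> 0"
      unfolding h_def using window_1_pos \<Phi>_nonneg[of 0] by (simp add: geg_beta_Suc)
    ultimately have 2: "(\<Sum>a<49. h (Suc a)) \<le> (\<Sum>a<49. h a)"
      by (simp only: sum.lessThan_Suc)
    show ?thesis using 1 2 unfolding h_def Sf by linarith
  qed
  finally have "3/1000 * window 1 * \<Phi> 1 \<le> ?S f" .
  moreover have "3/1000 * window 1 * (window 1 * (geg_H v (b + 1) * ?N\<^sup>2)) \<le> 3/1000 * window 1 * \<Phi> 1"
    using \<Phi>1 window_1_pos by (intro mult_left_mono) auto
  ultimately have lower: "3/1000 * (window 1)\<^sup>2 * geg_H v (b + 1) * ?N\<^sup>2 \<le> ?S f"
    by (simp add: power2_eq_square algebra_simps)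
  have "?S f \<le> (\<Sum>i\<in>I. \<Sum>j\<in>I. if i = j then poly f 1 else 0)"
    unfolding code_sum_def
  proof (intro sum_mono)
    fix i j assume ij: "i \<in> I" "j \<in> I"
    show "poly f (dot (v + 2) (x i) (x j)) \<le> (if i = j then poly f 1 else 0)"
    proof (cases "i = j")
      case True
      then show ?thesis using u[OF ij(1)] by (simp add: unit_vec_def)
    next
      case False
      define t where "t = dot (v + 2) (x i) (x j)"
      have "t - 1/2 \<le> 0" using sep[OF ij False] unfolding t_def v by simp
      then have "(t - 1/2) * (poly g t * poly g t) \<le> 0"
        by (intro mult_nonpos_nonneg) auto
      then have "poly f t \<le> 0" by (simp add: f_def algebra_simps)
      then show ?thesis using False by (simp add: t_def)
    qed
  qed
  also have "\<dots> = ?N * poly f 1" using fin by simp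
  also have "\<dots> = ?N * ((poly g 1)\<^sup>2 / 2)" by (simp add: f_def power2_eq_square)
  also have "\<dots> \<le> ?N * (((\<Sum>a<49. window (Suc a)) * poly (?q (b + 1)) 1)\<^sup>2 / 2)"
  proof -
    have nn: "poly g 1 \<ge> 0" unfolding g_def poly_sum
      using window_nonneg less_imp_le[OF geg_at_1_pos[OF v2(2)]] by (intro sum_nonneg) auto
    \<comment> \<open>Values at 1 do not increase with the degree, so the lowest one
      dominates.\<close>
    have "poly g 1 \<le> (\<Sum>a<49. window (Suc a) * poly (?q (b + 1)) 1)"
      unfolding g_def poly_sum poly_smult
      using window_nonneg v2(2) by (intro sum_mono mult_left_mono geg_at_1_antimono) auto
    then have "poly g 1 \<le> (\<Sum>a<49. window (Suc a)) * poly (?q (b + 1)) 1"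
      by (simp add: sum_distrib_right)
    then show ?thesis using nn by (intro mult_left_mono divide_right_mono power_mono) auto
  qed
  finally have upper: "?S f \<le> ?N * (((\<Sum>a<49. window (Suc a)) * poly (?q (b + 1)) 1)\<^sup>2 / 2)" .
  define W where "W = (\<Sum>a<49. window (Suc a))"
  have "?N * (6/1000 * (window 1)\<^sup>2 * geg_H v (b + 1) * ?N) \<le> ?N * (W\<^sup>2 * (poly (?q (b + 1)) 1)\<^sup>2)"
    using lower upper unfolding W_def[symmetric] by (simp add: power2_eq_square algebra_simps)
  then have "card I = 0 \<or> 6/1000 * (window 1)\<^sup>2 * geg_H v (b + 1) * ?N \<le> W\<^sup>2 * (poly (?q (b + 1)) 1)\<^sup>2"
    by (simp only: mult_le_cancel_left) auto
  moreover have "code_const \<ge> 0" by (simp add: code_const_def)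
  moreover have "b + 1 = 2 * m" using b1 by simp
  moreover have "6/1000 * (window 1)\<^sup>2 > 0" using window_1_pos by simp
  ultimately show ?thesis unfolding v_def[symmetric] code_const_def W_def[symmetric]
    by (auto simp: field_simps)
qed

text \<open>A single term of the expansion of \<open>(2/27 + 25/27)^(27m)\<close>, combined with
  \<open>27^27 / (2^2 * 25^25) < (4/3)^25\<close>.\<close>

lemma choose_27_2_le: "real ((27 * m) choose (2 * m)) \<le> (4/3) ^ (25 * m)"
proof -
  have "real ((27 * m) choose (2 * m)) * (2/27) ^ (2 * m) * (25/27) ^ (27 * m - 2 * m)
      \<le> (\<Sum>k\<le>27 * m. real ((27 * m) choose k) * (2/27) ^ k * (25/27) ^ (27 * m - k))"
    by (rule member_le_sum) auto
  also have "\<dots> = (2/27 + 25/27) ^ (27 * m)" by (rule binomial_ring[symmetric])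
  finally have "real ((27 * m) choose (2 * m)) * ((2/27) ^ (2 * m) * (25/27) ^ (25 * m)) \<le> 1"
    by (simp add: mult.assoc)
  moreover have "((2/27) ^ (2 * m) * (25/27) ^ (25 * m) :: real) = ((2/27) ^ 2 * (25/27) ^ 25) ^ m"
    by (simp only: power_mult power_mult_distrib)
  ultimately have 1: "real ((27 * m) choose (2 * m)) * ((2/27) ^ 2 * (25/27) ^ 25) ^ m \<le> 1" by simp
  have "(1::real) \<le> (4/3) ^ 25 * ((2/27) ^ 2 * (25/27) ^ 25)" by (simp add: power_divide)
  then have "(1::real) \<le> ((4/3) ^ 25 * ((2/27) ^ 2 * (25/27) ^ 25)) ^ m" by (rule one_le_power)
  also have "\<dots> = (4/3) ^ (25 * m) * ((2/27) ^ 2 * (25/27) ^ 25) ^ m"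
    by (simp only: power_mult power_mult_distrib)
  finally have "real ((27 * m) choose (2 * m)) * ((2/27) ^ 2 * (25/27) ^ 25) ^ m
      \<le> (4/3) ^ (25 * m) * ((2/27) ^ 2 * (25/27) ^ 25) ^ m" using 1 by linarith
  then show ?thesis by (rule mult_right_le_imp_le) simp
qed

lemma spherical_code_card_multiple:
  fixes x :: "'a \<Rightarrow> nat \<Rightarrow> real"
  assumes m: "m \<ge> 1" and "finite I"
    and "\<And>i. i \<in> I \<Longrightarrow> unit_vec (25 * m) (x i)"
    and "\<And>i j. i \<in> I \<Longrightarrow> j \<in> I \<Longrightarrow> i \<noteq> j \<Longrightarrow> dot (25 * m) (x i) (x j) \<le> 1/2"
  shows "real (card I) \<le> 2 * code_const * (4/3) ^ (25 * m)"
proof -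
  define v where "v = 25 * m - 2"
  define H q where "H = geg_H v (2 * m)" and "q = poly (geg v (2 * m)) 1"
  define B where "B = real ((2 * m + v - 1) choose (2 * m))"
  have v: "v \<ge> 1" and rv: "real v = 25 * real m - 2" using m by (simp_all add: v_def of_nat_diff)
  have H: "H > 0" unfolding H_def by (rule geg_H_pos[OF v])
  have C: "code_const \<ge> 0" by (simp add: code_const_def)
  have 1: "real (card I) * H \<le> code_const * q\<^sup>2"
    unfolding H_def q_def v_def by (rule spherical_code_card_geg[OF assms])
  have 2: "q\<^sup>2 * v = (2 * real (2 * m) + v) * B * H"
    unfolding H_def q_def B_def by (rule geg_at_1_square[OF v])
  \<comment> \<open>Here \<open>4 * m \<le> v\<close>, so the dimension of the harmonics is at most
    \<open>2 * B\<close>.\<close>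
  have "q\<^sup>2 * v \<le> (2 * v) * B * H"
    unfolding 2 using H m by (intro mult_right_mono) (auto simp: rv B_def)
  then have "q\<^sup>2 \<le> 2 * B * H" using v by simp
  then have "real (card I) * H \<le> code_const * (2 * B * H)"
    using 1 C by (meson mult_left_mono order_trans)
  then have "real (card I) \<le> 2 * code_const * B" using H by simp
  also have "B \<le> real ((27 * m) choose (2 * m))"
    unfolding B_def v_def using m by (intro of_nat_mono binomial_right_mono) auto
  also have "\<dots> \<le> (4/3) ^ (25 * m)" by (rule choose_27_2_le)
  finally show ?thesis using C by (simp add: mult_left_mono)
qed

text \<open>Every dimension is padded with zero coordinates to the next multiple of 25.\<close>

lemma spherical_code_card:
  fixes x :: "'a \<Rightarrow> nat \<Rightarrow> real"
  assumes "finite I"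
    and unit: "\<And>i. i \<in> I \<Longrightarrow> unit_vec d (x i)"
    and sep: "\<And>i j. i \<in> I \<Longrightarrow> j \<in> I \<Longrightarrow> i \<noteq> j \<Longrightarrow> dot d (x i) (x j) \<le> 1/2"
  shows "real (card I) \<le> 2 * code_const * (4/3) ^ 25 * (4/3) ^ d"
proof -
  define m where "m = d div 25 + 1"
  define y where "y i k = (if k < d then x i k else 0)" for i k
  have m: "m \<ge> 1" "d \<le> 25 * m" "25 * m \<le> 25 + d" unfolding m_def by simp_all
  have dot: "dot (25 * m) (y i) (y j) = dot d (x i) (x j)" for i j
    unfolding dot_def
    by (rule sum.mono_neutral_cong_right) (use m in \<open>auto simp: y_def\<close>)
  have "real (card I) \<le> 2 * code_const * (4/3) ^ (25 * m)"
    by (rule spherical_code_card_multiple[of _ _ y]) (use m assms in \<open>auto simp: dot unit_vec_def\<close>)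
  also have "\<dots> \<le> 2 * code_const * (4/3) ^ (25 + d)"
    using m by (intro mult_left_mono power_increasing) (auto simp: code_const_def)
  finally show ?thesis by (simp add: power_add mult.assoc)
qed

section \<open>Nearest neighbours on the torus\<close>

lemma dist_Z_le: "dist_Z x \<le> \<bar>x - of_int n\<bar>"
  unfolding dist_Z_def by (rule cINF_lower) (auto intro!: bdd_belowI[of _ 0])

lemma dist_Z_eq_round: "dist_Z x = \<bar>x - of_int (round x)\<bar>"
proof (rule antisym[OF dist_Z_le])
  show "\<bar>x - of_int (round x)\<bar> \<le> dist_Z x"
    unfolding dist_Z_def by (rule cINF_greatest) (auto intro: round_diff_minimal)
qed

lemma dist_Z_nonneg: "dist_Z x \<ge> 0"
  by (simp add: dist_Z_eq_round)

lemma dist_Z_minus: "dist_Z (- x) = dist_Z x"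
proof -
  have "dist_Z (- y) \<le> dist_Z y" for y
    using dist_Z_le[of "- y" "- round y"] unfolding dist_Z_eq_round[of y] by simp
  from this[of x] this[of "- x"] show ?thesis by simp
qed

text \<open>A shortest representative in Euclidean space, which gives torus points inner products
  and angles.\<close>

definition reduced :: "(nat \<Rightarrow> real) \<Rightarrow> nat \<Rightarrow> nat \<Rightarrow> real" where
  "reduced \<alpha> m k = wpt \<alpha> m k - of_int (round (wpt \<alpha> m k))"

lemma torus_norm_nonneg: "torus_norm d t \<ge> 0"
  by (simp add: torus_norm_def sum_nonneg)

lemma dot_reduced: "dot d (reduced \<alpha> m) (reduced \<alpha> m) = (torus_norm d (wpt \<alpha> m))\<^sup>2"
  by (simp add: dot_def torus_norm_def reduced_def dist_Z_eq_round sum_nonneg power2_eq_square)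

text \<open>The difference of the two representatives lies in the class of
  \<open>wpt \<alpha> (m - m')\<close>, hence is at least as long as its torus norm; its square is
  expanded.\<close>

lemma torus_norm_wpt_diff_le:
  assumes "m' \<le> m"
  shows "(torus_norm d (wpt \<alpha> (m - m')))\<^sup>2 \<le> (torus_norm d (wpt \<alpha> m))\<^sup>2 + (torus_norm d (wpt \<alpha> m'))\<^sup>2
    - 2 * dot d (reduced \<alpha> m) (reduced \<alpha> m')"
proof -
  have "(torus_norm d (wpt \<alpha> (m - m')))\<^sup>2 = (\<Sum>k<d. (dist_Z (wpt \<alpha> (m - m') k))\<^sup>2)"
    by (simp add: torus_norm_def sum_nonneg)
  also have "\<dots> \<le> (\<Sum>k<d. (reduced \<alpha> m k - reduced \<alpha> m' k)\<^sup>2)"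
  proof (rule sum_mono)
    fix k
    have "dist_Z (wpt \<alpha> (m - m') k) \<le> \<bar>reduced \<alpha> m k - reduced \<alpha> m' k\<bar>"
      using dist_Z_le[of "wpt \<alpha> (m - m') k" "round (wpt \<alpha> m k) - round (wpt \<alpha> m' k)"] assms
      by (simp add: reduced_def wpt_def of_nat_diff algebra_simps)
    then show "(dist_Z (wpt \<alpha> (m - m') k))\<^sup>2 \<le> (reduced \<alpha> m k - reduced \<alpha> m' k)\<^sup>2"
      using dist_Z_nonneg by (metis power2_abs power_mono)
  qed
  also have "\<dots> = dot d (reduced \<alpha> m) (reduced \<alpha> m) + dot d (reduced \<alpha> m') (reduced \<alpha> m')
      - 2 * dot d (reduced \<alpha> m) (reduced \<alpha> m')"
    by (simp add: dot_def sum.distrib[symmetric] sum_subtractf[symmetric] sum_distrib_left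
        power2_eq_square algebra_simps)
  finally show ?thesis by (simp add: dot_reduced)
qed

definition kiss_const :: real where
  "kiss_const = 2 * code_const * (4/3) ^ 25"

text \<open>In a triangle whose third side is at least as long as the others, the opposite angle is
  at least 60 degrees, so the normalised representatives form a spherical code.\<close>

lemma card_separated_multiples:
  fixes \<alpha> :: "nat \<Rightarrow> real" and d :: nat
  defines "r \<equiv> \<lambda>m. torus_norm d (wpt \<alpha> m)"
  assumes "finite M" and pos: "\<And>m. m \<in> M \<Longrightarrow> r m > 0"
    and sep: "\<And>m m'. m \<in> M \<Longrightarrow> m' \<in> M \<Longrightarrow> m' < m \<Longrightarrow> r m \<le> r (m - m') \<and> r m' \<le> r (m - m')"
  shows "real (card M) \<le> kiss_const * (4/3) ^ d"
proof -
  define x where "x m k = reduced \<alpha> m k / r m" for m k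
  have dot_x: "dot d (x m) (x m') = dot d (reduced \<alpha> m) (reduced \<alpha> m') / (r m * r m')" for m m'
    by (simp add: dot_def x_def sum_divide_distrib)
  have less: "dot d (x m) (x m') \<le> 1/2" if "m \<in> M" "m' \<in> M" "m' < m" for m m'
  proof -
    have p: "r m > 0" "r m' > 0" using pos that by auto
    have s: "r m \<le> r (m - m')" "r m' \<le> r (m - m')" using sep[OF that] by auto
    have "2 * dot d (reduced \<alpha> m) (reduced \<alpha> m') \<le> (r m)\<^sup>2 + (r m')\<^sup>2 - (r (m - m'))\<^sup>2"
      using torus_norm_wpt_diff_le[of m' m d \<alpha>] that(3) by (simp add: r_def)
    \<comment> \<open>The larger square is absorbed by that of \<open>r (m - m')\<close>, and the
      smaller is at most the product.\<close>
    also have "\<dots> \<le> r m * r m'"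
    proof (cases "r m \<le> r m'")
      case True
      have "(r m')\<^sup>2 \<le> (r (m - m'))\<^sup>2" using s p by (intro power_mono) auto
      moreover have "(r m)\<^sup>2 \<le> r m * r m'" using True p by (simp add: power2_eq_square)
      ultimately show ?thesis by linarith
    next
      case False
      have "(r m)\<^sup>2 \<le> (r (m - m'))\<^sup>2" using s p by (intro power_mono) auto
      moreover have "(r m')\<^sup>2 \<le> r m * r m'" using False p by (simp add: power2_eq_square)
      ultimately show ?thesis by linarith
    qed
    finally show ?thesis unfolding dot_x using p by (simp add: field_simps)
  qed
  have "dot d (x m) (x m') \<le> 1/2" if "m \<in> M" "m' \<in> M" "m \<noteq> m'" for m m'
    using less[of m m'] less[of m' m] that
    by (cases "m' < m") (auto simp: dot_def mult.commute)
  moreover have "unit_vec d (x m)" if "m \<in> M" for m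
    using pos[OF that] unfolding unit_vec_def dot_x dot_reduced by (simp add: r_def power2_eq_square)
  ultimately show ?thesis unfolding kiss_const_def
    using spherical_code_card[OF assms(2), of d x] by blast
qed

text \<open>Multiples of norm zero cannot be normalised; together they contribute a single
  element.\<close>

lemma torus_class_wpt_eq_0:
  assumes "torus_norm d (wpt \<alpha> m) = 0" "s \<in> {1, -1}"
  shows "torus_class d (\<lambda>k. s * wpt \<alpha> m k) = (\<lambda>k. 0)"
proof
  fix k
  have "s * wpt \<alpha> m k \<in> \<int>" if "k < d"
  proof -
    have "(\<Sum>k<d. (dist_Z (wpt \<alpha> m k))\<^sup>2) = 0" using assms(1) by (simp add: torus_norm_def)
    then have "dist_Z (wpt \<alpha> m k) = 0"
      using that by (subst (asm) sum_nonneg_eq_0_iff) auto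
    then have "wpt \<alpha> m k = of_int (round (wpt \<alpha> m k))" by (simp add: dist_Z_eq_round)
    then have "wpt \<alpha> m k \<in> \<int>" by (metis Ints_of_int)
    then show ?thesis using assms(2) by auto
  qed
  then show "torus_class d (\<lambda>k. s * wpt \<alpha> m k) k = 0"
    by (auto simp: torus_class_def frac_eq_0_iff)
qed

section \<open>Counting the nearest neighbour differences\<close>

lemma torus_norm_wpt_diff:
  "torus_norm d (\<lambda>k. wpt \<alpha> i k - wpt \<alpha> j k) = torus_norm d (wpt \<alpha> (if j < i then i - j else j - i))"
proof -
  have "dist_Z (wpt \<alpha> i k - wpt \<alpha> j k) = dist_Z (wpt \<alpha> (if j < i then i - j else j - i) k)" for k
  proof (cases "j < i")
    case True
    then show ?thesis by (simp add: wpt_def of_nat_diff algebra_simps)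
  next
    case False
    then have "wpt \<alpha> i k - wpt \<alpha> j k = - wpt \<alpha> (j - i) k" by (simp add: wpt_def of_nat_diff algebra_simps)
    then show ?thesis using False by (simp add: dist_Z_minus)
  qed
  then show ?thesis by (simp add: torus_norm_def)
qed

lemma card_nearest_differences:
  fixes d N :: nat and \<alpha> :: "nat \<Rightarrow> real" and j :: "nat \<Rightarrow> nat"
  assumes nearest: "\<forall>i\<in>{1..N}. j i \<in> {1..N} \<and> j i \<noteq> i \<and>
          (\<forall>j'\<in>{1..N}. j' \<noteq> i \<longrightarrow>
             torus_norm d (\<lambda>k. wpt \<alpha> i k - wpt \<alpha> (j i) k)
               \<le> torus_norm d (\<lambda>k. wpt \<alpha> i k - wpt \<alpha> j' k))"
  shows "real (card {torus_class d (\<lambda>k. s * (wpt \<alpha> i k - wpt \<alpha> (j i) k)) | s i.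
                     s \<in> {1, -1} \<and> i \<in> {1..N}})
         \<le> (1 + 4 * kiss_const) * (4/3) ^ d"
    (is "real (card ?D) \<le> _")
proof -
  define r where "r m = torus_norm d (wpt \<alpha> m)" for m
  define gap where "gap i = (if j i < i then i - j i else j i - i)" for i
  \<comment> \<open>Two gaps on the same side of \<open>(N - 1) / 2\<close> differ by at most
    \<open>(N - 1) / 2\<close>, which lies within both ranges of minimality.\<close>
  define A where "A = {m \<in> gap ` {1..N}. r m > 0 \<and> 2 * m < N - 1}"
  define B where "B = {m \<in> gap ` {1..N}. r m > 0 \<and> 2 * m \<ge> N - 1}"
  have fin: "finite A" "finite B" by (simp_all add: A_def B_def)
  have minimal: "\<exists>R. m \<le> R \<and> R \<le> N - 1 \<and> N - 1 \<le> 2 * R \<and> (\<forall>l. 1 \<le> l \<longrightarrow> l \<le> R \<longrightarrow> r m \<le> r l)"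
    if gap: "m \<in> gap ` {1..N}" for m
  proof -
    obtain i where i: "i \<in> {1..N}" and m: "m = gap i" using gap by blast
    have ji: "j i \<in> {1..N}" "j i \<noteq> i" using nearest i by auto
    have "r m \<le> r l" if "1 \<le> l" "l \<le> max (i - 1) (N - i)" for l
    proof -
      \<comment> \<open>If \<open>l < i\<close> fails then \<open>l > i - 1\<close>, so
        \<open>l \<le> N - i\<close> and the index \<open>i + l\<close> is available.\<close>
      define j' where "j' = (if l < i then i - l else i + l)"
      have j': "j' \<in> {1..N}" "j' \<noteq> i" using that i by (auto simp: j'_def)
      have "r m = torus_norm d (\<lambda>k. wpt \<alpha> i k - wpt \<alpha> (j i) k)"
        unfolding torus_norm_wpt_diff by (simp add: r_def m gap_def)
      also have "\<dots> \<le> torus_norm d (\<lambda>k. wpt \<alpha> i k - wpt \<alpha> j' k)"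
        using nearest i j' by blast
      also have "\<dots> = r l"
        unfolding torus_norm_wpt_diff r_def using that i
        by (intro arg_cong[of _ _ "\<lambda>l. torus_norm d (wpt \<alpha> l)"]) (auto simp: j'_def)
      finally show ?thesis .
    qed
    then show ?thesis using i ji
      by (intro exI[of _ "max (i - 1) (N - i)"]) (auto simp: m gap_def)
  qed
  have A: "real (card A) \<le> kiss_const * (4/3) ^ d"
  proof (rule card_separated_multiples[where \<alpha> = \<alpha>])
    fix m m' assume mm: "m \<in> A" "m' \<in> A" "m' < m"
    obtain R where R: "m \<le> R" "\<And>l. 1 \<le> l \<Longrightarrow> l \<le> R \<Longrightarrow> r m \<le> r l"
      using minimal[of m] mm(1) by (auto simp: A_def)
    obtain R' where R': "N - 1 \<le> 2 * R'" "\<And>l. 1 \<le> l \<Longrightarrow> l \<le> R' \<Longrightarrow> r m' \<le> r l"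
      using minimal[of m'] mm(2) by (auto simp: A_def)
    have "m - m' \<le> R" "m - m' \<le> R'" "1 \<le> m - m'" using mm R(1) R'(1) by (auto simp: A_def)
    then show "torus_norm d (wpt \<alpha> m) \<le> torus_norm d (wpt \<alpha> (m - m')) \<and>
        torus_norm d (wpt \<alpha> m') \<le> torus_norm d (wpt \<alpha> (m - m'))"
      using R(2) R'(2) unfolding r_def by blast
  qed (use fin in \<open>auto simp: A_def r_def\<close>)
  have B: "real (card B) \<le> kiss_const * (4/3) ^ d"
  proof (rule card_separated_multiples[where \<alpha> = \<alpha>])
    fix m m' assume mm: "m \<in> B" "m' \<in> B" "m' < m"
    obtain R where R: "m \<le> R" "R \<le> N - 1" "\<And>l. 1 \<le> l \<Longrightarrow> l \<le> R \<Longrightarrow> r m \<le> r l"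
      using minimal[of m] mm(1) by (auto simp: B_def)
    obtain R' where R': "N - 1 \<le> 2 * R'" "\<And>l. 1 \<le> l \<Longrightarrow> l \<le> R' \<Longrightarrow> r m' \<le> r l"
      using minimal[of m'] mm(2) by (auto simp: B_def)
    have "N - 1 \<le> 2 * m'" using mm(2) by (simp add: B_def)
    then have "m - m' \<le> R" "m - m' \<le> R'" "1 \<le> m - m'" using mm(3) R(1,2) R'(1) by auto
    then show "torus_norm d (wpt \<alpha> m) \<le> torus_norm d (wpt \<alpha> (m - m')) \<and>
        torus_norm d (wpt \<alpha> m') \<le> torus_norm d (wpt \<alpha> (m - m'))"
      using R(3) R'(2) unfolding r_def by blast
  qed (use fin in \<open>auto simp: B_def r_def\<close>)
  define cls where "cls = (\<lambda>(s::real, m). torus_class d (\<lambda>k. s * wpt \<alpha> m k))"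
  have "?D \<subseteq> insert (\<lambda>k. 0) (cls ` ({1, -1} \<times> (A \<union> B)))"
  proof
    fix y assume "y \<in> ?D"
    then obtain s i where y: "y = torus_class d (\<lambda>k. s * (wpt \<alpha> i k - wpt \<alpha> (j i) k))"
      and s: "s \<in> {1, -1}" and i: "i \<in> {1..N}" by blast
    \<comment> \<open>The sign absorbs the orientation lost in \<open>gap\<close>.\<close>
    define s' where "s' = (if j i < i then s else - s)"
    have s': "s' \<in> {1, -1}" using s by (auto simp: s'_def)
    have "(\<lambda>k. s * (wpt \<alpha> i k - wpt \<alpha> (j i) k)) = (\<lambda>k. s' * wpt \<alpha> (gap i) k)"
      by (auto simp: s'_def gap_def wpt_def of_nat_diff algebra_simps not_less)
    then have y': "y = cls (s', gap i)" by (simp add: y cls_def)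
    show "y \<in> insert (\<lambda>k. 0) (cls ` ({1, -1} \<times> (A \<union> B)))"
    proof (cases "r (gap i) > 0")
      case True
      then have "gap i \<in> A \<union> B" using i by (auto simp: A_def B_def)
      then show ?thesis using y' s' by blast
    next
      case False
      then have "torus_norm d (wpt \<alpha> (gap i)) = 0"
        using torus_norm_nonneg[of d "wpt \<alpha> (gap i)"] by (simp add: r_def)
      then show ?thesis using torus_class_wpt_eq_0[OF _ s'] by (simp add: y' cls_def)
    qed
  qed
  then have "card ?D \<le> card (insert (\<lambda>k. 0) (cls ` ({1, -1} \<times> (A \<union> B))))"
    using fin by (intro card_mono) auto
  also have "\<dots> \<le> Suc (card (cls ` ({1, -1} \<times> (A \<union> B))))"
    by (rule card_insert_le_m1[THEN order_trans]) auto
  also have "\<dots> \<le> Suc (card ({1, -1 :: real} \<times> (A \<union> B)))"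
    unfolding Suc_le_mono using fin by (intro card_image_le) simp
  also have "\<dots> \<le> Suc (2 * (card A + card B))"
    using card_Un_le[of A B] by (simp add: card_cartesian_product)
  finally have "real (card ?D) \<le> real (Suc (2 * (card A + card B)))"
    by (rule of_nat_mono)
  also have "\<dots> = 1 + 2 * (real (card A) + real (card B))" by simp
  \<comment> \<open>The zero class counts 1, absorbed by \<open>(4/3) ^ d\<close>; the factor 4 is
    two signs times two parts.\<close>
  also have "\<dots> \<le> (4/3) ^ d + 4 * (kiss_const * (4/3) ^ d)"
  proof -
    have "1 \<le> (4/3 :: real) ^ d" by (rule one_le_power) simp
    then show ?thesis using A B unfolding distrib_left by linarith
  qed
  finally show ?thesis by (simp add: algebra_simps)
qed

theorem theorem3:
  shows "\<exists>K::real. K > 0 \<and>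
    (\<forall>(d::nat) (N::nat) (\<alpha>::nat \<Rightarrow> real) (j::nat \<Rightarrow> nat).
       d \<ge> 1 \<longrightarrow> N \<ge> 2 \<longrightarrow>
       (\<forall>i\<in>{1..N}. j i \<in> {1..N} \<and> j i \<noteq> i \<and>
          (\<forall>j'\<in>{1..N}. j' \<noteq> i \<longrightarrow>
             torus_norm d (\<lambda>k. wpt \<alpha> i k - wpt \<alpha> (j i) k)
               \<le> torus_norm d (\<lambda>k. wpt \<alpha> i k - wpt \<alpha> j' k))) \<longrightarrow>
       real (card {torus_class d (\<lambda>k. s * (wpt \<alpha> i k - wpt \<alpha> (j i) k)) | s i.
                     s \<in> {1, -1} \<and> i \<in> {1..N}})
         \<le> K * (4/3) ^ d)"
proof (intro exI[of _ "1 + 4 * kiss_const"] conjI allI impI)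
  show "1 + 4 * kiss_const > 0"
    by (simp add: kiss_const_def code_const_def add_pos_nonneg)
qed (rule card_nearest_differences)

end
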